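(* Let $F$ be a field (finite or infinite) with $|F|>3$, and let $N$ be a normal subgroup of $SL_2(F)$ containing some non-scalar matrix. Then $N\supset P$, where $P$ is the subgroup of $SL_2(F)$ consisting of the matrices $\begin{pmatrix}1&0\\ r&1\end{pmatrix}$, $r\in F$; and so $N=SL_2(F)$. Consequently $PSL_2(F)$ is simple.
   Context: $SL_2(F)$ is the group of $2\times2$ matrices of determinant 1 over $F$, and $PSL_2(F)$ is the quotient of $SL_2(F)$ by its subgroup of scalar matrices $\{\pm I\}$. *)

theory Defs
  imports "HOL-Analysis.Determinants" "HOL-Algebra.Coset"
begin

definition SL2 :: "('a::field ^ 2 ^ 2) monoid" where
  "SL2 = \<lparr>carrier = {A. det A = 1}, mult = (**), one = mat 1\<rparr>"

lemma group_SL2: "group (SL2 :: ('a::field ^ 2 ^ 2) monoid)"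
proof (rule groupI)
  fix A :: "'a ^ 2 ^ 2" assume "A \<in> carrier SL2"
  then have d: "det A = 1" by (simp add: SL2_def)
  then have "invertible A" by (simp add: invertible_det_nz)
  then obtain B where B: "A ** B = mat 1" "B ** A = mat 1" by (auto simp: invertible_def)
  have "det B = 1" using det_mul[of A B] B d by simp
  with B show "\<exists>B\<in>carrier SL2. B \<otimes>\<^bsub>SL2\<^esub> A = \<one>\<^bsub>SL2\<^esub>" by (auto simp: SL2_def)
qed (auto simp: SL2_def det_mul matrix_mul_assoc)

definition scalar_matrix :: "'a::field ^ 2 ^ 2 \<Rightarrow> bool" where
  "scalar_matrix A \<longleftrightarrow> (\<exists>c. A = mat c)"

definition SL2_scalars :: "('a::field ^ 2 ^ 2) set" where
  "SL2_scalars = {A \<in> carrier SL2. scalar_matrix A}"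

lemma SL2_scalars_eq: "SL2_scalars = {mat 1, - mat 1 :: 'a::field ^ 2 ^ 2}"
proof -
  have m: "- mat 1 = (mat (- 1) :: 'a ^ 2 ^ 2)" by (simp add: mat_def vec_eq_iff)
  have d: "det (mat c :: 'a ^ 2 ^ 2) = 1 \<longleftrightarrow> c = 1 \<or> c = - 1" for c :: 'a
    by (simp add: det_2 mat_def square_eq_1_iff)
  show ?thesis unfolding m by (auto simp: SL2_scalars_def SL2_def scalar_matrix_def d)
qed

definition PSL2 :: "('a::field ^ 2 ^ 2) set monoid" where
  "PSL2 = SL2 Mod SL2_scalars"

definition SL2_lower_unipotent :: "('a::field ^ 2 ^ 2) set" where
  "SL2_lower_unipotent = {vector [vector [1, 0], vector [r, 1]] | r. True}"

lemma subgroup_SL2_lower_unipotent: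
  "subgroup SL2_lower_unipotent (SL2 :: ('a::field ^ 2 ^ 2) monoid)"
proof -
  interpret group "SL2 :: ('a ^ 2 ^ 2) monoid" by (rule group_SL2)
  let ?L = "\<lambda>r::'a. vector [vector [1, 0], vector [r, 1]] :: 'a ^ 2 ^ 2"
  have mul: "?L r ** ?L s = ?L (r + s)" for r s
    by (simp add: vec_eq_iff forall_2 matrix_matrix_mult_def sum_2 vector_2)
  have one: "?L 0 = mat 1"
    by (simp add: vec_eq_iff forall_2 mat_def vector_2)
  have car: "?L r \<in> carrier SL2" for r
    by (simp add: SL2_def det_2 vector_2)
  have inv: "inv\<^bsub>SL2\<^esub> (?L r) = ?L (- r)" for r
  proof (rule inv_equality[OF _ car car])
    show "?L (- r) \<otimes>\<^bsub>SL2\<^esub> ?L r = \<one>\<^bsub>SL2\<^esub>"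
      using mul[of "- r" r] one by (simp add: SL2_def)
  qed
  show ?thesis
  proof (rule subgroupI)
    show "SL2_lower_unipotent \<subseteq> carrier (SL2 :: ('a ^ 2 ^ 2) monoid)"
      using car by (auto simp: SL2_lower_unipotent_def)
    show "(SL2_lower_unipotent :: ('a ^ 2 ^ 2) set) \<noteq> {}"
      by (auto simp: SL2_lower_unipotent_def)
    show "inv\<^bsub>SL2\<^esub> A \<in> SL2_lower_unipotent"
      if "A \<in> SL2_lower_unipotent" for A :: "'a ^ 2 ^ 2"
      using that inv unfolding SL2_lower_unipotent_def by blast
    show "A \<otimes>\<^bsub>SL2\<^esub> B \<in> SL2_lower_unipotent"
      if "A \<in> SL2_lower_unipotent" "B \<in> SL2_lower_unipotent" for A B :: "'a ^ 2 ^ 2"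
    proof -
      from that obtain r s where "A = ?L r" "B = ?L s"
        by (auto simp: SL2_lower_unipotent_def)
      then have "A \<otimes>\<^bsub>SL2\<^esub> B = ?L (r + s)" using mul by (simp add: SL2_def)
      then show ?thesis by (auto simp: SL2_lower_unipotent_def)
    qed
  qed
qed

(* The locale simple_group of HOL-Algebra demands order G > 1; as the cardinality of an
   infinite set is 0, it excludes all infinite groups.  Here nontriviality is required instead. *)
definition is_simple :: "('g, 'x) monoid_scheme \<Rightarrow> bool" where
  "is_simple G \<longleftrightarrow> group G \<and> carrier G \<noteq> {\<one>\<^bsub>G\<^esub>} \<and>
     (\<forall>H. H \<lhd> G \<longrightarrow> H = carrier G \<or> H = {\<one>\<^bsub>G\<^esub>})"

end

theory Submission
  imports Defs
begin

text \<open>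
  Let \<open>N\<close> be normal in \<open>SL2\<close> and contain a non-scalar matrix.  After conjugation \<open>N\<close> contains a
  matrix \<open>A\<close> with rows \<open>(0, -1/u)\<close> and \<open>(u, t)\<close>, where \<open>u \<noteq> 0\<close> and \<open>t\<close> is the trace.  Conjugation
  by the diagonal matrix with entries \<open>a\<close> and \<open>1/a\<close> preserves the zero in the corner of \<open>A\<close>, so
  its commutator with \<open>A\<close> comes out lower triangular, with diagonal entries \<open>a\<^sup>2\<close> and
  \<open>1/a\<^sup>2\<close> (\<open>normal_SL2_contains_lower_triangular\<close>).  As the field has more than three elements,
  there is such an \<open>a\<close> outside \<open>{0, 1, -1}\<close>.

  If \<open>a ^ 4 \<noteq> 1\<close>, the commutators of this triangular matrix with the lower unipotent matrices are
  already all the lower unipotent matrices.  Otherwise \<open>a\<^sup>2 = -1\<close>, so the characteristic is not 2,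
  and the triangular matrix is \<open>-1\<close> times a unipotent matrix with lower left entry \<open>2 * u * t\<close>.
  For \<open>t \<noteq> 0\<close> its square is a nontrivial element of \<open>P\<close>; diagonal conjugation multiplies the
  lower left entry by squares, and every field element is a difference of two squares, so again
  \<open>P \<subseteq> N\<close>.  For \<open>t = 0\<close> a commutator of \<open>A\<close> with a lower unipotent matrix has trace
  \<open>2 + a\<^sup>2 = 1\<close> and can replace \<open>A\<close>.  This argument covers the field with five elements, where
  every nonzero \<open>a\<close> satisfies \<open>a ^ 4 = 1\<close>, along with all the others.

  Finally the conjugates of \<open>P\<close> contain the upper unipotent matrices, and these generate \<open>SL2\<close>
  together with \<open>P\<close>.  Simplicity of \<open>PSL2\<close> follows by pulling a normal subgroup of the quotient
  back to \<open>SL2\<close>.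
\<close>

section \<open>Two-by-two matrices of determinant one\<close>

abbreviation mat22 :: "'a::field \<Rightarrow> 'a \<Rightarrow> 'a \<Rightarrow> 'a \<Rightarrow> 'a ^ 2 ^ 2" where
  "mat22 a b c d \<equiv> vector [vector [a, b], vector [c, d]]"

lemma mat22_eq_iff:
  "mat22 a b c d = mat22 a' b' c' d' \<longleftrightarrow> a = a' \<and> b = b' \<and> c = c' \<and> d = d'"
  by (auto simp: vec_eq_iff forall_2 vector_2)

lemma mat22_exhaust:
  fixes A :: "'a::field ^ 2 ^ 2"
  obtains a b c d where "A = mat22 a b c d"
proof
  show "A = mat22 (A $ 1 $ 1) (A $ 1 $ 2) (A $ 2 $ 1) (A $ 2 $ 2)"
    by (simp add: vec_eq_iff forall_2 vector_2)
qed

lemma mult_mat22: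
  "mat22 a b c d \<otimes>\<^bsub>SL2\<^esub> mat22 a' b' c' d' =
     mat22 (a * a' + b * c') (a * b' + b * d') (c * a' + d * c') (c * b' + d * d')"
  by (simp add: SL2_def vec_eq_iff forall_2 matrix_matrix_mult_def sum_2 vector_2)

lemma mat22_in_SL2_iff: "mat22 a b c d \<in> carrier SL2 \<longleftrightarrow> a * d - b * c = 1"
  by (simp add: SL2_def det_2 vector_2)

lemma one_SL2: "\<one>\<^bsub>SL2\<^esub> = mat22 1 0 0 1"
  by (simp add: SL2_def vec_eq_iff forall_2 mat_def vector_2)

lemma inv_mat22:
  assumes "a * d - b * c = 1"
  shows "inv\<^bsub>SL2\<^esub> (mat22 a b c d) = mat22 d (- b) (- c) a"
proof (rule group.inv_equality[OF group_SL2])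
  show "mat22 d (- b) (- c) a \<otimes>\<^bsub>SL2\<^esub> mat22 a b c d = \<one>\<^bsub>SL2\<^esub>"
    using assms by (simp add: mult_mat22 one_SL2 mat22_eq_iff algebra_simps)
qed (use assms in \<open>auto simp: mat22_in_SL2_iff algebra_simps\<close>)

lemma scalar_mat22_iff:
  fixes a b c d :: "'a::field"
  shows "scalar_matrix (mat22 a b c d) \<longleftrightarrow> b = 0 \<and> c = 0 \<and> a = d"
proof -
  have "mat e = mat22 e 0 0 e" for e :: 'a
    by (simp add: vec_eq_iff forall_2 mat_def vector_2)
  then show ?thesis by (auto simp: scalar_matrix_def mat22_eq_iff)
qed

section \<open>Normal subgroups of the special linear group\<close>

lemma normal_SL2_mult:
  assumes "N \<lhd> SL2" "A \<in> N" "B \<in> N"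
  shows "A \<otimes>\<^bsub>SL2\<^esub> B \<in> N"
  by (rule subgroup.m_closed[OF normal_imp_subgroup[OF assms(1)] assms(2,3)])

lemma normal_SL2_conj:
  assumes "N \<lhd> SL2" "mat22 p q r s \<in> N" "a * d - b * c = 1"
  shows "mat22 a b c d \<otimes>\<^bsub>SL2\<^esub> mat22 p q r s \<otimes>\<^bsub>SL2\<^esub> mat22 d (- b) (- c) a \<in> N"
  using normal.inv_op_closed2[OF assms(1) _ assms(2), of "mat22 a b c d"] assms(3)
  by (simp add: mat22_in_SL2_iff inv_mat22)

lemma normal_SL2_inv:
  assumes "N \<lhd> SL2" "mat22 p q r s \<in> N"
  shows "p * s - q * r = 1" "mat22 s (- q) (- r) p \<in> N"
proof -
  have "mat22 p q r s \<in> carrier SL2"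
    by (rule subgroup.mem_carrier[OF normal_imp_subgroup[OF assms(1)] assms(2)])
  then show *: "p * s - q * r = 1" by (simp add: mat22_in_SL2_iff)
  have "inv\<^bsub>SL2\<^esub> (mat22 p q r s) \<in> N"
    by (rule subgroup.m_inv_closed[OF normal_imp_subgroup[OF assms(1)] assms(2)])
  then show "mat22 s (- q) (- r) p \<in> N" by (simp add: inv_mat22[OF *])
qed

text \<open>A companion-like form: conjugation first makes the lower left entry nonzero, and an upper
  unipotent matrix then clears the upper left one.\<close>

lemma normal_SL2_contains_companion:
  fixes N :: "('a::field ^ 2 ^ 2) set"
  assumes N: "N \<lhd> SL2" and A: "A \<in> N" "\<not> scalar_matrix A"
  obtains u t where "u \<noteq> 0" "mat22 0 (- 1 / u) u t \<in> N"
proof -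
  obtain p q r s where A_eq: "A = mat22 p q r s" by (rule mat22_exhaust)
  have mem: "mat22 p q r s \<in> N" and ns: "q \<noteq> 0 \<or> r \<noteq> 0 \<or> p \<noteq> s"
    using A by (auto simp: A_eq scalar_mat22_iff)
  have "\<exists>p q r s. r \<noteq> 0 \<and> mat22 p q r s \<in> N"
  proof -
    consider "r \<noteq> 0" | "r = 0" "q \<noteq> 0" | "r = 0" "q = 0" "p \<noteq> s" using ns by blast
    then show ?thesis
    proof cases
      case 1
      then show ?thesis using mem by blast
    next
      case 2
      have "mat22 s (- r) (- q) p \<in> N"
        using normal_SL2_conj[OF N mem, of 0 0 1 "- 1"] by (simp add: mult_mat22)
      then show ?thesis using 2 by (meson neg_equal_0_iff_equal)
    next
      case 3
      have "mat22 p 0 (p - s) s \<in> N"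
        using normal_SL2_conj[OF N mem, of 1 1 0 1] 3 by (simp add: mult_mat22)
      then show ?thesis using 3 by (meson right_minus_eq)
    qed
  qed
  then obtain p q u s where u: "u \<noteq> 0" and B: "mat22 p q u s \<in> N" by blast
  have "p * s - q * u = 1" by (rule normal_SL2_inv(1)[OF N B])
  then have q: "q = (p * s - 1) / u" using u by (simp add: field_simps)
  have "mat22 0 (- 1 / u) u (p + s) \<in> N"
    using normal_SL2_conj[OF N B, of 1 1 "- p / u" 0] u
    by (simp add: mult_mat22 q field_simps)
  with u show thesis by (rule that)
qed

text \<open>The commutator of the diagonal matrix with entries \<open>a\<close> and \<open>1/a\<close> with a companion-like
  matrix: the zero in the corner of the latter makes it triangular.\<close>

lemma normal_SL2_contains_lower_triangular:
  fixes N :: "('a::field ^ 2 ^ 2) set"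
  assumes N: "N \<lhd> SL2" and A: "mat22 0 (- 1 / u) u t \<in> N" and "u \<noteq> 0" "a \<noteq> 0"
  shows "mat22 (a^2) 0 (u * t * (1 / a^2 - 1)) (1 / a^2) \<in> N"
  using normal_SL2_mult[OF N normal_SL2_conj[OF N A, of a "1 / a" 0 0] normal_SL2_inv(2)[OF N A]]
    assms(3,4)
  by (simp add: mult_mat22 power2_eq_square field_simps)

text \<open>The commutator of a lower unipotent matrix with a triangular one scales the lower left entry
  by \<open>1 - 1/e\<^sup>2\<close>, which is invertible when \<open>e\<^sup>2 \<noteq> 1\<close>.\<close>

lemma normal_SL2_lower_unipotent_from_triangular:
  fixes N :: "('a::field ^ 2 ^ 2) set"
  assumes N: "N \<lhd> SL2" and B: "mat22 e 0 c (1 / e) \<in> N" and e: "e \<noteq> 0" "e^2 \<noteq> 1"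
  shows "mat22 1 0 r 1 \<in> N"
proof -
  have comm: "mat22 1 0 (x * (1 - 1 / e^2)) 1 \<in> N" for x
  proof -
    have "mat22 1 0 x 1 \<otimes>\<^bsub>SL2\<^esub> mat22 e 0 c (1 / e) \<otimes>\<^bsub>SL2\<^esub> mat22 1 (- 0) (- x) 1
            \<otimes>\<^bsub>SL2\<^esub> mat22 (1 / e) (- 0) (- c) e = mat22 1 0 (x * (1 - 1 / e^2)) 1"
      using e(1) by (simp add: mult_mat22 mat22_eq_iff power2_eq_square field_simps)
    then show ?thesis
      using normal_SL2_mult[OF N normal_SL2_conj[OF N B, of 1 1 0 x] normal_SL2_inv(2)[OF N B]]
      by simp
  qed
  have "1 - 1 / e^2 \<noteq> 0" using e by (simp add: field_simps)
  then show ?thesis using comm[of "r / (1 - 1 / e^2)"] by simp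
qed

text \<open>Conjugation by diagonal matrices multiplies the lower left entry by nonzero squares, and when
  2 is invertible every element is a difference of two squares, by
  \<open>x = ((x + 1) / 2)\<^sup>2 - ((x - 1) / 2)\<^sup>2\<close>.\<close>

lemma normal_SL2_lower_unipotent_from_one:
  fixes N :: "('a::field ^ 2 ^ 2) set"
  assumes N: "N \<lhd> SL2" and C: "mat22 1 0 c 1 \<in> N" and c: "c \<noteq> 0" and two: "(2::'a) \<noteq> 0"
  shows "mat22 1 0 r 1 \<in> N"
proof -
  have one: "mat22 1 0 0 1 \<in> N"
    using normal_SL2_mult[OF N C normal_SL2_inv(2)[OF N C]] by (simp add: mult_mat22)
  have sq: "mat22 1 0 (c * b^2) 1 \<in> N" for b
  proof (cases "b = 0")
    case True
    then show ?thesis using one by simp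
  next
    case False
    then show ?thesis using normal_SL2_conj[OF N C, of "1 / b" b 0 0]
      by (simp add: mult_mat22 power2_eq_square field_simps)
  qed
  have diff: "mat22 1 0 (c * b^2 - c * b'^2) 1 \<in> N" for b b'
    using normal_SL2_mult[OF N sq[of b] normal_SL2_inv(2)[OF N sq[of b']]]
    by (simp add: mult_mat22)
  have four: "(4::'a) \<noteq> 0" using two by (metis mult_2 mult_eq_0_iff numeral_Bit0)
  have "((x + 1) / 2)^2 - ((x - 1) / 2)^2 = x" for x :: 'a
  proof -
    have "((x + 1) / 2)^2 - ((x - 1) / 2)^2 = ((x + 1)^2 - (x - 1)^2) / 4"
      by (simp add: power_divide flip: diff_divide_distrib)
    also have "(x + 1)^2 - (x - 1)^2 = 4 * x"
      by (simp add: power2_eq_square algebra_simps)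
    finally show ?thesis using four by simp
  qed
  then have "c * (((r / c + 1) / 2)^2 - ((r / c - 1) / 2)^2) = r"
    using c by simp
  then have "c * ((r / c + 1) / 2)^2 - c * ((r / c - 1) / 2)^2 = r"
    by (simp only: right_diff_distrib)
  with diff[of "(r / c + 1) / 2" "(r / c - 1) / 2"] show ?thesis by simp
qed

text \<open>The triangular element of \<open>N\<close> has diagonal \<open>a\<^sup>2, 1/a\<^sup>2\<close>.  Taking commutators with it works
  when \<open>a ^ 4 \<noteq> 1\<close>.  When \<open>a ^ 4 = 1\<close> its eigenvalues coincide at \<open>-1\<close>, and its square takes over.\<close>

lemma normal_SL2_contains_lower_unipotent:
  fixes N :: "('a::field ^ 2 ^ 2) set"
  assumes a: "a \<noteq> (0::'a)" "a \<noteq> 1" "a \<noteq> - 1"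
    and N: "N \<lhd> SL2" and A: "A \<in> N" "\<not> scalar_matrix A"
  shows "mat22 1 0 r 1 \<in> N"
proof (cases "(a^2)^2 = 1")
  case False
  obtain u t where u: "u \<noteq> 0" and B: "mat22 0 (- 1 / u) u t \<in> N"
    using normal_SL2_contains_companion[OF N A] .
  show ?thesis
    by (rule normal_SL2_lower_unipotent_from_triangular[OF N
          normal_SL2_contains_lower_triangular[OF N B u a(1)]]) (use a False in auto)
next
  case True
  \<comment> \<open>In characteristic 2 this would say \<open>a\<^sup>2 = 1\<close>, so the characteristic is different.\<close>
  have a2: "a^2 = - 1" using True a power2_eq_1_iff by blast
  have two: "(2::'a) \<noteq> 0"
  proof
    assume "(2::'a) = 0"
    then have "(- 1::'a) = 1" by (metis add_eq_0_iff one_add_one)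
    with a2 a show False by (metis power2_eq_1_iff)
  qed
  have "\<exists>u t. u \<noteq> 0 \<and> t \<noteq> 0 \<and> mat22 0 (- 1 / u) u t \<in> N"
  proof -
    obtain u t where u: "u \<noteq> 0" and B: "mat22 0 (- 1 / u) u t \<in> N"
      using normal_SL2_contains_companion[OF N A] .
    show ?thesis
    proof (cases "t = 0")
      case False
      with u B show ?thesis by blast
    next
      case True
      \<comment> \<open>The commutator with the lower unipotent matrix of entry \<open>a * u\<close> has trace
        \<open>2 + a\<^sup>2 = 1\<close>; clearing its upper left entry then gives the wanted form.\<close>
      have "mat22 1 0 (a * u) 1 \<otimes>\<^bsub>SL2\<^esub> mat22 0 (- 1 / u) u t \<otimes>\<^bsub>SL2\<^esub> mat22 1 (- 0) (- (a * u)) 1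
              \<otimes>\<^bsub>SL2\<^esub> mat22 t (- (- 1 / u)) (- u) 0 = mat22 1 (a / u) (a * u) (1 + a^2)"
        using u True by (simp add: mult_mat22 mat22_eq_iff power2_eq_square field_simps)
      then have D: "mat22 1 (a / u) (a * u) 0 \<in> N"
        using normal_SL2_mult[OF N normal_SL2_conj[OF N B, of 1 1 0 "a * u"]
            normal_SL2_inv(2)[OF N B]]
        by (simp add: a2)
      have "a / u = a^2 / (a * u)" using a(1) by (simp add: power2_eq_square)
      then have "a / u = - 1 / (a * u)" by (simp only: a2)
      then have "mat22 0 (- 1 / (a * u)) (a * u) 1 \<in> N"
        using normal_SL2_conj[OF N D, of 1 1 "- 1 / (a * u)" 0] u a(1)
        by (simp add: mult_mat22)
      then show ?thesis using u a(1)
        by (intro exI[of _ "a * u"] exI[of _ 1]) simp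
    qed
  qed
  then obtain u t where u: "u \<noteq> 0" "t \<noteq> 0" and B: "mat22 0 (- 1 / u) u t \<in> N" by blast
  have T: "mat22 (- 1) 0 (- (2 * (u * t))) (- 1) \<in> N"
    using normal_SL2_contains_lower_triangular[OF N B u(1) a(1)] by (simp add: a2 algebra_simps)
  have "mat22 1 0 (4 * (u * t)) 1 \<in> N"
    using normal_SL2_mult[OF N T T] by (simp add: mult_mat22 mult.commute)
  moreover have "4 * (u * t) \<noteq> 0"
    using two u by (metis mult_2 mult_eq_0_iff numeral_Bit0)
  ultimately show ?thesis using normal_SL2_lower_unipotent_from_one[OF N] two by blast
qed

text \<open>The Weyl element conjugates lower to upper unipotent matrices.  A matrix with upper right
  entry \<open>q \<noteq> 0\<close> is a product lower times upper times lower, the two outer factors being determined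
  by the diagonal; multiplying by one upper unipotent matrix makes that entry nonzero.\<close>

lemma normal_SL2_with_lower_unipotent_eq:
  fixes N :: "('a::field ^ 2 ^ 2) set"
  assumes N: "N \<lhd> SL2" and L: "\<And>r. mat22 1 0 r 1 \<in> N"
  shows "N = carrier SL2"
proof
  show "N \<subseteq> carrier SL2" by (rule subgroup.subset[OF normal_imp_subgroup[OF N]])
  have U: "mat22 1 x 0 1 \<in> N" for x
    using normal_SL2_conj[OF N L[of "- x"], of 0 0 1 "- 1"] by (simp add: mult_mat22)
  have nz: "mat22 p q r s \<in> N" if q: "q \<noteq> 0" and det: "p * s - q * r = 1" for p q r s
  proof -
    have r: "r = (p * s - 1) / q" using q det by (simp add: field_simps)
    have "mat22 1 0 ((s - 1) / q) 1 \<otimes>\<^bsub>SL2\<^esub> mat22 1 q 0 1 \<otimes>\<^bsub>SL2\<^esub> mat22 1 0 ((p - 1) / q) 1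
            = mat22 p q r s"
      using q by (simp add: mult_mat22 mat22_eq_iff r field_simps)
    then show ?thesis
      using normal_SL2_mult[OF N normal_SL2_mult[OF N L[of "(s - 1) / q"] U[of q]]
          L[of "(p - 1) / q"]]
      by simp
  qed
  show "carrier SL2 \<subseteq> N"
  proof
    fix A :: "'a ^ 2 ^ 2" assume A: "A \<in> carrier SL2"
    obtain p q r s where A_eq: "A = mat22 p q r s" by (rule mat22_exhaust)
    have det: "p * s - q * r = 1" using A by (simp add: A_eq mat22_in_SL2_iff)
    show "A \<in> N"
    proof (cases "q = 0")
      case False
      then show ?thesis using nz det A_eq by simp
    next
      case True
      then have "p \<noteq> 0" using det by auto
      then have "mat22 p p r (r + s) \<in> N"
        using nz[where p = p and q = p and r = r and s = "r + s"] det True by (simp add: algebra_simps)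
      from normal_SL2_mult[OF N this U[of "- 1"]] show ?thesis
        by (simp add: mult_mat22 A_eq True)
    qed
  qed
qed

section \<open>The projective quotient\<close>

lemma normal_SL2_scalars: "SL2_scalars \<lhd> (SL2 :: ('a::field ^ 2 ^ 2) monoid)"
proof -
  interpret group "SL2 :: ('a ^ 2 ^ 2) monoid" by (rule group_SL2)
  have mem: "A \<in> SL2_scalars \<longleftrightarrow> (\<exists>c. A = mat22 c 0 0 c \<and> c * c = 1)" for A :: "'a ^ 2 ^ 2"
    by (cases A rule: mat22_exhaust)
      (auto simp: SL2_scalars_def scalar_mat22_iff mat22_in_SL2_iff mat22_eq_iff)
  show ?thesis
    unfolding normal_inv_iff
  proof (intro conjI ballI)
    show "subgroup SL2_scalars (SL2 :: ('a ^ 2 ^ 2) monoid)"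
    proof (rule subgroupI)
      show "SL2_scalars \<subseteq> carrier (SL2 :: ('a ^ 2 ^ 2) monoid)" by (auto simp: SL2_scalars_def)
      show "(SL2_scalars :: ('a ^ 2 ^ 2) set) \<noteq> {}" by (simp add: SL2_scalars_eq)
    qed (auto simp: mem inv_mat22 mult_mat22 mat22_eq_iff algebra_simps)
  next
    fix A C :: "'a ^ 2 ^ 2" assume A: "A \<in> carrier SL2" and C: "C \<in> SL2_scalars"
    obtain c where C_eq: "C = mat22 c 0 0 c" using C mem by blast
    have "A \<otimes>\<^bsub>SL2\<^esub> C = C \<otimes>\<^bsub>SL2\<^esub> A"
      by (cases A rule: mat22_exhaust) (simp add: C_eq mult_mat22 mult.commute)
    moreover have "C \<in> carrier SL2" using C by (simp add: SL2_scalars_def)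
    ultimately have "A \<otimes>\<^bsub>SL2\<^esub> C \<otimes>\<^bsub>SL2\<^esub> inv\<^bsub>SL2\<^esub> A = C"
      using A by (simp add: m_assoc)
    then show "A \<otimes>\<^bsub>SL2\<^esub> C \<otimes>\<^bsub>SL2\<^esub> inv\<^bsub>SL2\<^esub> A \<in> SL2_scalars"
      using C by simp
  qed
qed

text \<open>A normal subgroup of the quotient is determined by its preimage, which is either the whole
  group or consists of scalars.\<close>

lemma is_simple_PSL2_if_normal_SL2_nonscalar:
  assumes whole: "\<And>N :: ('a::field ^ 2 ^ 2) set.
      N \<lhd> SL2 \<Longrightarrow> \<exists>A\<in>N. \<not> scalar_matrix A \<Longrightarrow> N = carrier SL2"
  shows "is_simple (PSL2 :: ('a ^ 2 ^ 2) set monoid)"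
proof -
  interpret Z: normal SL2_scalars "SL2 :: ('a ^ 2 ^ 2) monoid" by (rule normal_SL2_scalars)
  interpret Q: group "PSL2 :: ('a ^ 2 ^ 2) set monoid"
    unfolding PSL2_def by (rule Z.factorgroup_is_group)
  have one: "\<one>\<^bsub>PSL2\<^esub> = (SL2_scalars :: ('a ^ 2 ^ 2) set)"
    by (simp add: PSL2_def FactGroup_def)
  have carrier_iff: "C \<in> carrier PSL2 \<longleftrightarrow> (\<exists>A\<in>carrier SL2. C = SL2_scalars #>\<^bsub>SL2\<^esub> A)"
    for C :: "('a ^ 2 ^ 2) set"
    by (simp add: PSL2_def FactGroup_def RCOSETS_def)
  have "carrier PSL2 \<noteq> {\<one>\<^bsub>PSL2\<^esub> :: ('a ^ 2 ^ 2) set}"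
  proof
    assume triv: "carrier PSL2 = {\<one>\<^bsub>PSL2\<^esub> :: ('a ^ 2 ^ 2) set}"
    let ?A = "mat22 1 0 1 1 :: 'a ^ 2 ^ 2"
    have A: "?A \<in> carrier SL2" by (simp add: mat22_in_SL2_iff)
    have "SL2_scalars #>\<^bsub>SL2\<^esub> ?A \<in> carrier PSL2"
      unfolding carrier_iff by (rule bexI[OF refl A])
    then have "SL2_scalars #>\<^bsub>SL2\<^esub> ?A = SL2_scalars" unfolding triv one by (rule singletonD)
    with Z.rcos_self[OF A Z.subgroup_axioms] have "?A \<in> SL2_scalars" by (simp only:)
    then have "scalar_matrix ?A" unfolding SL2_scalars_def by blast
    then show False unfolding scalar_mat22_iff by simp
  qed
  moreover have "H = carrier PSL2 \<or> H = {\<one>\<^bsub>PSL2\<^esub>}"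
    if H: "H \<lhd> PSL2" for H :: "('a ^ 2 ^ 2) set set"
  proof -
    interpret H: normal H "PSL2 :: ('a ^ 2 ^ 2) set monoid" by (rule H)
    have un: "\<Union>H \<lhd> SL2"
      using Z.factgroup_subgroup_union_normal H unfolding PSL2_def by blast
    have un_iff: "A \<in> \<Union>H \<longleftrightarrow> A \<in> carrier SL2 \<and> SL2_scalars #>\<^bsub>SL2\<^esub> A \<in> H" for A
      using Z.factgroup_subgroup_union_char[of H] H.subgroup_axioms unfolding PSL2_def by blast
    have H_iff: "C \<in> H \<longleftrightarrow> (\<exists>A\<in>\<Union>H. C = SL2_scalars #>\<^bsub>SL2\<^esub> A)" for C
    proof
      assume C: "C \<in> H"
      then obtain A where "A \<in> carrier SL2" "C = SL2_scalars #>\<^bsub>SL2\<^esub> A"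
        using H.subset carrier_iff by blast
      with C show "\<exists>A\<in>\<Union>H. C = SL2_scalars #>\<^bsub>SL2\<^esub> A" unfolding un_iff Bex_def by blast
    next
      assume "\<exists>A\<in>\<Union>H. C = SL2_scalars #>\<^bsub>SL2\<^esub> A"
      then show "C \<in> H" unfolding un_iff Bex_def by blast
    qed
    show ?thesis
    proof (cases "\<exists>A\<in>\<Union>H. \<not> scalar_matrix A")
      case True
      have union: "\<Union>H = carrier SL2" by (rule whole[OF un True])
      have "H = carrier PSL2"
        by (rule Set.set_eqI) (simp only: H_iff carrier_iff union)
      then show ?thesis ..
    next
      case False
      have "C = SL2_scalars" if "C \<in> H" for C
      proof -
        from that[unfolded H_iff] obtain A
          where A: "A \<in> \<Union>H" and C: "C = SL2_scalars #>\<^bsub>SL2\<^esub> A" by (rule bexE)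
        have "A \<in> carrier SL2" by (rule subgroup.mem_carrier[OF normal_imp_subgroup[OF un] A])
        moreover have "scalar_matrix A" using A False by blast
        ultimately have "A \<in> SL2_scalars" unfolding SL2_scalars_def by blast
        then show ?thesis unfolding C by (rule Z.rcos_const[OF Z.group_axioms])
      qed
      then have "H = {\<one>\<^bsub>PSL2\<^esub>}" using H.one_closed unfolding one by blast
      then show ?thesis ..
    qed
  qed
  ultimately show ?thesis unfolding is_simple_def using Q.group_axioms by blast
qed

theorem proposition6p3:
  assumes "infinite (UNIV :: 'a::field set) \<or> card (UNIV :: 'a set) > 3"
  shows "(\<forall>N :: ('a ^ 2 ^ 2) set. N \<lhd> SL2 \<and> (\<exists>A\<in>N. \<not> scalar_matrix A) \<longrightarrow>
            SL2_lower_unipotent \<subseteq> N \<and> N = carrier SL2)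
         \<and> is_simple (PSL2 :: ('a ^ 2 ^ 2) set monoid)"
proof -
  have "\<not> (UNIV :: 'a set) \<subseteq> {0, 1, - 1}"
  proof
    assume sub: "(UNIV :: 'a set) \<subseteq> {0, 1, - 1}"
    then have "finite (UNIV :: 'a set)" by (rule finite_subset) simp
    moreover have "card (UNIV :: 'a set) \<le> card {0, 1, - 1 :: 'a}"
      using sub by (intro card_mono) auto
    \<comment> \<open>Bounding by the length of a list also covers characteristic 2, where \<open>1 = -1\<close>.\<close>
    moreover have "card {0, 1, - 1 :: 'a} \<le> 3"
      using card_length[of "[0, 1, - 1 :: 'a]"] by simp
    ultimately show False using assms by simp
  qed
  then obtain a :: 'a where a: "a \<noteq> 0" "a \<noteq> 1" "a \<noteq> - 1" by auto
  have L: "mat22 1 0 r 1 \<in> N"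
    if "N \<lhd> SL2" "\<exists>A\<in>N. \<not> scalar_matrix A" for N :: "('a ^ 2 ^ 2) set" and r
    using that normal_SL2_contains_lower_unipotent[OF a] by blast
  have whole: "N = carrier SL2"
    if "N \<lhd> SL2" "\<exists>A\<in>N. \<not> scalar_matrix A" for N :: "('a ^ 2 ^ 2) set"
    using normal_SL2_with_lower_unipotent_eq[OF that(1)] L[OF that] by blast
  have lower: "SL2_lower_unipotent \<subseteq> N"
    if "N \<lhd> SL2" "\<exists>A\<in>N. \<not> scalar_matrix A" for N :: "('a ^ 2 ^ 2) set"
    using L[OF that] by (auto simp: SL2_lower_unipotent_def)
  show ?thesis
  proof (intro conjI allI impI)
    show "is_simple (PSL2 :: ('a ^ 2 ^ 2) set monoid)"
      by (rule is_simple_PSL2_if_normal_SL2_nonscalar[OF whole])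
  qed (elim conjE, rule lower whole, assumption+)+
qed

end
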